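(* Consider $n$ agents indexed by $\mathcal{V}=\{1,\dots,n\}$ communicating over a time-varying directed graph $\mathcal{G}(\mathcal{A}(t))$ with nonnegative weights $a_{ij}(t)$, where $a_{ij}(t)>0$ if and only if $j\in N_i(t)$ (agent $i$ receives information from agent $j$ at time $t$). Assume: (i) the CFP solution set $\mathbf{X}^*$ is non-empty; (ii) the graph is balanced, i.e. $\sum_{j=1}^n a_{ij}(t)=\sum_{j=1}^n a_{ji}(t)$ for all $i$ and all $t\ge0$; (iii) the $\delta$-graph $\mathcal{G}_{(\delta,T)}$ is strongly connected. Let each agent have state $x_i(t)\in\mathbb{R}^m$ evolving according to $$\dot x_i(t)=\sum_{j\in N_i(t)} a_{ij}(t)\big(x_j(t)-x_i(t)\big)+\phi_i(t),\qquad \phi_i(t)=-\tau\Big(\big[x_i(t)-P_{X_i}(x_i(t))\big]+\nabla g_i^+(x_i(t))\Big),$$ with $\tau>0$. If $\lim_{t\to\infty}\phi_i(t)=0$ for every $i\in\mathcal{V}$, then the agents reach consensus asymptotically and there is a point $x^*\in\mathbf{X}^*$ with $\lim_{t\to\infty}x_i(t)=x^*$ for every $i$.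
   Context: For each $i$, $g_i:\mathbb{R}^m\to\mathbb{R}$ is convex and continuous, $X_i\subset\mathbb{R}^m$ is closed and convex, $X=\bigcap_i X_i$. The CFP asks for $x$ with $g_i(x)\le0$ for all $i$ and $x\in X$; $\mathbf{X}^*$ is its solution set. $g_i^+(x)=\max[g_i(x),0]$; $P_{X_i}$ is the Euclidean projection onto $X_i$; $\nabla g_i^+(x)$ is a subgradient of $g_i^+$ at $x$, chosen as $0$ if $g_i(x)\le0$ and as a subgradient of $g_i$ at $x$ otherwise, assumed piecewise continuous in $x$. For positive constants $T,\delta$, the $\delta$-graph is $\mathcal{G}_{(\delta,T)}=(\mathcal{V},\mathcal{E}_{(\delta,T)})$ with $\mathcal{E}_{(\delta,T)}=\{(j,i): \int_t^{t+T}a_{ij}(s)\,ds\ge\delta \text{ for all } t\ge0\}$; assumption (iii) means there exist $T,\delta>0$ for which this directed graph is strongly connected. Consensus means $\lim_{t\to\infty}\|x_i(t)-x_j(t)\|=0$ for all $i,j$. *)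

theory Defs
  imports "HOL-Analysis.Analysis"
begin

text \<open>Solution set of the convex feasibility problem (CFP):
  all x with g_i x <= 0 for every i and x in X = Inter of the X_i.\<close>
definition cfp_solutions :: "('i \<Rightarrow> 'a \<Rightarrow> real) \<Rightarrow> ('i \<Rightarrow> 'a set) \<Rightarrow> 'a set" where
  "cfp_solutions g X = {x. (\<forall>i. g i x \<le> 0) \<and> x \<in> (\<Inter>i. X i)}"

text \<open>v is a subgradient of f at x.\<close>
definition is_subgradient :: "('a::real_inner \<Rightarrow> real) \<Rightarrow> 'a \<Rightarrow> 'a \<Rightarrow> bool" where
  "is_subgradient f x v \<longleftrightarrow> (\<forall>y. f x + inner v (y - x) \<le> f y)"

text \<open>Edge set of the delta-graph: (j,i) is an edge iff the integral of a_ij over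
  every window [t, t+T], t >= 0, is at least delta.\<close>
definition delta_edges :: "('i \<Rightarrow> 'i \<Rightarrow> real \<Rightarrow> real) \<Rightarrow> real \<Rightarrow> real \<Rightarrow> ('i \<times> 'i) set" where
  "delta_edges a \<delta> T = {(j, i). \<forall>t\<ge>0. integral {t..t + T} (a i j) \<ge> \<delta>}"

text \<open>A directed graph with edge set E on the vertex type 'i is strongly connected.\<close>
definition strongly_connected :: "('i \<times> 'i) set \<Rightarrow> bool" where
  "strongly_connected E \<longleftrightarrow> (\<forall>u v. (u, v) \<in> E\<^sup>*)"

text \<open>phi_i(t) = -tau ((x_i - P_{X_i}(x_i)) + grad g_i^+(x_i)).\<close>
definition phi :: "real \<Rightarrow> ('i \<Rightarrow> 'a::euclidean_space set) \<Rightarrow> ('i \<Rightarrow> 'a \<Rightarrow> 'a)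
    \<Rightarrow> ('i \<Rightarrow> real \<Rightarrow> 'a) \<Rightarrow> 'i \<Rightarrow> real \<Rightarrow> 'a" where
  "phi \<tau> X dg x i t = - \<tau> *\<^sub>R ((x i t - closest_point (X i) (x i t)) + dg i (x i t))"

text \<open>Right-hand side of the dynamics of agent i at time t.\<close>
definition flow_rhs :: "('i::finite \<Rightarrow> 'i \<Rightarrow> real \<Rightarrow> real) \<Rightarrow> real \<Rightarrow> ('i \<Rightarrow> 'a::euclidean_space set)
    \<Rightarrow> ('i \<Rightarrow> 'a \<Rightarrow> 'a) \<Rightarrow> ('i \<Rightarrow> real \<Rightarrow> 'a) \<Rightarrow> 'i \<Rightarrow> real \<Rightarrow> 'a" where
  "flow_rhs a \<tau> X dg x i t =
     (\<Sum>j\<in>{j. 0 < a i j t}. a i j t *\<^sub>R (x j t - x i t)) + phi \<tau> X dg x i t"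

text \<open>x is a (Caratheodory) solution of the dynamics on [0, infinity):
  each x_i is the indefinite Lebesgue integral of the right-hand side.\<close>
definition is_solution :: "('i::finite \<Rightarrow> 'i \<Rightarrow> real \<Rightarrow> real) \<Rightarrow> real \<Rightarrow> ('i \<Rightarrow> 'a::euclidean_space set)
    \<Rightarrow> ('i \<Rightarrow> 'a \<Rightarrow> 'a) \<Rightarrow> ('i \<Rightarrow> real \<Rightarrow> 'a) \<Rightarrow> bool" where
  "is_solution a \<tau> X dg x \<longleftrightarrow>
     (\<forall>i t. 0 \<le> t \<longrightarrow>
        flow_rhs a \<tau> X dg x i absolutely_integrable_on {0..t} \<and>
        (flow_rhs a \<tau> X dg x i has_integral (x i t - x i 0)) {0..t})"

end

theory Submission
  imports Defs
begin

text \<open>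
  The squared distance to any solution c decreases at least at the rate
  \<open>\<Sum> a\<^sub>i\<^sub>j |x\<^sub>j - x\<^sub>i|\<^sup>2\<close>, so the dissipation over windows of length T tends to 0.
  The weights are not assumed bounded, so the states may still move fast inside a window. But for
  a fixed semiconvex function F, balance makes \<open>\<Sum>\<^sub>i F(z\<^sub>i)\<close> of the b-coordinates
  \<open>z\<^sub>i = x\<^sub>i \<bullet> b\<close> grow by at most a multiple of the dissipation plus an error due to
  \<open>\<phi>\<close>. If F is a bump supported in a gap between the \<open>z\<^sub>i\<close>, then no agent can cross the
  gap during the window, and a delta-edge across the gap forces a fixed amount of dissipation.
  Hence gaps vanish and consensus follows. Finally \<open>\<phi> \<longlonglongrightarrow> 0\<close> makes every cluster point feasible,
  and monotonicity of the squared distance to a feasible cluster point gives convergence to it.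
\<close>

section \<open>Calculus for indefinite integrals\<close>

lemma continuous_on_indefinite_integral:
  fixes f :: "real \<Rightarrow> 'b::banach"
  assumes "a \<le> b" "\<And>t. t \<in> {a..b} \<Longrightarrow> (f has_integral (z t - z a)) {a..t}"
  shows "continuous_on {a..b} z"
proof -
  have "f integrable_on {a..b}" using assms by auto
  then have "continuous_on {a..b} (\<lambda>t. z a + integral {a..t} f)"
    by (intro continuous_intros indefinite_integral_continuous_1)
  moreover have "z t = z a + integral {a..t} f" if "t \<in> {a..b}" for t
    using assms(2)[OF that] by (simp add: integral_unique)
  ultimately show ?thesis
    by (metis (no_types, lifting) continuous_on_cong)
qed

text \<open>A Caratheodory solution need not be differentiable at every time, so the chain rule is
  needed in integrated form. Absolute integrability of \<open>f\<close> makes it work: the error on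
  a short interval is at most \<open>e\<close> times the integral of \<open>\<bar>f t\<bar>\<close>,
  and these integrals add up over subintervals.\<close>

lemma chain_rule_indefinite_integral:
  fixes z f F F' :: "real \<Rightarrow> real"
  assumes ab: "a \<le> b" and f: "f absolutely_integrable_on {a..b}"
    and z: "\<And>t. t \<in> {a..b} \<Longrightarrow> (f has_integral (z t - z a)) {a..t}"
    and F: "\<And>y. (F has_real_derivative F' y) (at y)" and F': "continuous_on UNIV F'"
  shows "((\<lambda>t. F' (z t) * f t) has_integral F (z b) - F (z a)) {a..b}"
proof -
  have fi: "f integrable_on {a..b}" and fn: "(\<lambda>t. \<bar>f t\<bar>) integrable_on {a..b}"
    using f unfolding absolutely_integrable_on_def by auto
  have zc: "continuous_on {a..b} z"
    by (rule continuous_on_indefinite_integral[OF ab z])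
  have F'z: "continuous_on {a..b} (\<lambda>t. F' (z t))"
    by (rule continuous_on_compose2[OF F' zc]) auto
  have abs: "(\<lambda>t. F' (z t) * f t) absolutely_integrable_on {a..b}"
  proof (rule absolutely_integrable_bounded_measurable_product_real[OF _ _ _ f])
    show "(\<lambda>t. F' (z t)) \<in> borel_measurable (lebesgue_on {a..b})"
      using F'z by (intro continuous_imp_measurable_on_sets_lebesgue) auto
    show "bounded ((\<lambda>t. F' (z t)) ` {a..b})"
      using F'z by (intro compact_imp_bounded compact_continuous_image) auto
  qed auto
  have Gi: "(\<lambda>t. F' (z t) * f t) integrable_on {a..b}"
    using abs set_lebesgue_integral_eq_integral(1) by blast
  define I where "I = (\<lambda>u v. integral {u..v} (\<lambda>t. F' (z t) * f t))"
  txt \<open>The increment of F along z is compared with the integral on short subintervals by the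
    mean value theorem; the Bolzano rule adds the estimates up.\<close>
  have main: "\<bar>F (z b) - F (z a) - I a b\<bar> \<le> e * integral {a..b} (\<lambda>t. \<bar>f t\<bar>)" if e: "e > 0" for e
  proof -
    define P where "P = (\<lambda>u v. a \<le> u \<and> u \<le> v \<and> v \<le> b \<longrightarrow>
       \<bar>F (z v) - F (z u) - I u v\<bar> \<le> e * integral {u..v} (\<lambda>t. \<bar>f t\<bar>))"
    have "P a b"
      using ab
    proof (induction rule: Bolzano)
      case (trans u v w)
      show ?case unfolding P_def
      proof
        assume *: "a \<le> u \<and> u \<le> w \<and> w \<le> b"
        have "I u v + I v w = I u w"
          unfolding I_def using * trans(3,4)
          by (intro Henstock_Kurzweil_Integration.integral_combine integrable_subinterval_real[OF Gi]) auto
        moreover have "integral {u..v} (\<lambda>t. \<bar>f t\<bar>) + integral {v..w} (\<lambda>t. \<bar>f t\<bar>) = integral {u..w} (\<lambda>t. \<bar>f t\<bar>)"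
          using * trans(3,4) by (intro Henstock_Kurzweil_Integration.integral_combine integrable_subinterval_real[OF fn]) auto
        then have "e * integral {u..v} (\<lambda>t. \<bar>f t\<bar>) + e * integral {v..w} (\<lambda>t. \<bar>f t\<bar>) = e * integral {u..w} (\<lambda>t. \<bar>f t\<bar>)"
          by (metis distrib_left)
        ultimately show "\<bar>F (z w) - F (z u) - I u w\<bar> \<le> e * integral {u..w} (\<lambda>t. \<bar>f t\<bar>)"
          using trans * unfolding P_def by linarith
      qed
    next
      case (local x)
      \<comment> \<open>Half of \<open>e\<close> suffices because two values of \<open>F'\<close>
        will be compared, both taken near \<open>z x\<close>.\<close>
      obtain d1 where d1: "d1 > 0" "\<And>y. \<bar>y - z x\<bar> < d1 \<Longrightarrow> \<bar>F' y - F' (z x)\<bar> < e / 2"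
        using F' e unfolding continuous_on_iff dist_real_def
        by (metis UNIV_I half_gt_zero)
      obtain d where d: "d > 0" "\<And>t. t \<in> {a..b} \<Longrightarrow> \<bar>t - x\<bar> < d \<Longrightarrow> \<bar>z t - z x\<bar> < d1"
        using zc local d1(1) unfolding continuous_on_iff dist_real_def
        by (metis atLeastAtMost_iff)
      show ?case
      proof (intro exI[of _ d] conjI allI impI d(1))
        fix u v assume uv: "u \<le> x \<and> x \<le> v \<and> v - u < d"
        show "P u v" unfolding P_def
        proof
          assume *: "a \<le> u \<and> u \<le> v \<and> v \<le> b"
          have near: "\<bar>z t - z x\<bar> < d1" if "t \<in> {u..v}" for t
            using that uv * by (intro d(2)) auto
          \<comment> \<open>\<open>y\<close> is the mean value point between \<open>z u\<close> and
            \<open>z v\<close>. If these coincide, any \<open>y\<close> satisfies the equation, and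
            \<open>z x\<close> is taken to stay in the neighbourhood.\<close>
          obtain y where y: "\<bar>y - z x\<bar> < d1" "F (z v) - F (z u) = F' y * (z v - z u)"
          proof (cases "z u = z v")
            case True
            then show ?thesis using that[of "z x"] d1(1) by simp
          next
            case False
            then show ?thesis
            proof (cases "z u < z v")
              case True
              from MVT2[OF this, of F F'] F obtain y where "y > z u" "y < z v" "F (z v) - F (z u) = (z v - z u) * F' y"
                by blast
              then show ?thesis using that[of y] near[of u] near[of v] * by (auto simp: mult.commute)
            next
              case F2: False
              with False have "z v < z u" by simp
              from MVT2[OF this, of F F'] F obtain y where "y > z v" "y < z u" "F (z u) - F (z v) = (z u - z v) * F' y"
                by blast
              then show ?thesis using that[of y] near[of u] near[of v] * by (auto simp: algebra_simps)
            qed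
          qed
          have zu: "(f has_integral (z v - z u)) {u..v}"
          proof -
            have "integral {a..u} f + integral {u..v} f = integral {a..v} f"
              using * by (intro Henstock_Kurzweil_Integration.integral_combine integrable_subinterval_real[OF fi]) auto
            moreover have "integral {a..u} f = z u - z a" "integral {a..v} f = z v - z a"
              using z * by (auto intro!: integral_unique)
            ultimately have "integral {u..v} f = z v - z u" by linarith
            moreover have "f integrable_on {u..v}"
              using * by (intro integrable_subinterval_real[OF fi]) auto
            ultimately show ?thesis by (metis integrable_integral)
          qed
          have Guv: "(\<lambda>t. F' (z t) * f t) integrable_on {u..v}" 
            using * by (intro integrable_subinterval_real[OF Gi]) auto
          have "((\<lambda>t. F' y * f t - F' (z t) * f t) has_integral (F' y * (z v - z u) - I u v)) {u..v}"
            unfolding I_def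
            by (intro has_integral_diff has_integral_mult_right zu integrable_integral Guv)
          then have Di: "F' y * (z v - z u) - I u v = integral {u..v} (\<lambda>t. F' y * f t - F' (z t) * f t)"
            and di: "(\<lambda>t. F' y * f t - F' (z t) * f t) integrable_on {u..v}"
            by (auto simp: integral_unique)
          have "\<bar>integral {u..v} (\<lambda>t. F' y * f t - F' (z t) * f t)\<bar> \<le> integral {u..v} (\<lambda>t. e * \<bar>f t\<bar>)"
          proof (rule Henstock_Kurzweil_Integration.integral_norm_bound_integral[OF di, unfolded real_norm_def])
            show "(\<lambda>t. e * \<bar>f t\<bar>) integrable_on {u..v}"
              using * by (intro integrable_on_mult_right integrable_subinterval_real[OF fn]) auto
            fix t assume "t \<in> {u..v}"
            then have "\<bar>F' y - F' (z t)\<bar> \<le> e"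
              using d1(2)[OF y(1)] d1(2)[OF near[of t]] by linarith
            then have "\<bar>F' y - F' (z t)\<bar> * \<bar>f t\<bar> \<le> e * \<bar>f t\<bar>"
              by (intro mult_right_mono) auto
            then show "\<bar>F' y * f t - F' (z t) * f t\<bar> \<le> e * \<bar>f t\<bar>"
              by (simp add: abs_mult left_diff_distrib flip: left_diff_distrib)
          qed
          then show "\<bar>F (z v) - F (z u) - I u v\<bar> \<le> e * integral {u..v} (\<lambda>t. \<bar>f t\<bar>)"
            using y(2) Di by simp
        qed
      qed
    qed
    then show ?thesis using ab by (simp add: P_def)
  qed
  have "\<bar>F (z b) - F (z a) - I a b\<bar> \<le> 0 + e" if "e > 0" for e
  proof -
    \<comment> \<open>Dividing by \<open>K + 1\<close> instead of \<open>K\<close> covers the case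
      \<open>K = 0\<close>.\<close>
    define K where "K = integral {a..b} (\<lambda>t. \<bar>f t\<bar>)"
    have "K \<ge> 0" unfolding K_def by (intro integral_nonneg fn) auto
    then have "e / (K + 1) * K \<le> e" using that by (auto simp: divide_simps mult_left_mono)
    moreover have "\<bar>F (z b) - F (z a) - I a b\<bar> \<le> e / (K + 1) * K"
      unfolding K_def using main[of "e / (K+1)"] that \<open>K \<ge> 0\<close> K_def by (simp add: divide_simps)
    ultimately show ?thesis by simp
  qed
  then have "F (z b) - F (z a) = I a b"
    using field_le_epsilon[of "\<bar>F (z b) - F (z a) - I a b\<bar>" 0] by fastforce
  then show "((\<lambda>t. F' (z t) * f t) has_integral F (z b) - F (z a)) {a..b}"
    using Gi unfolding I_def by auto
qed

section \<open>Crossing edges, gaps in finite sets, and balance\<close>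

lemma strongly_connected_crossing_edge:
  assumes "strongly_connected E" "p \<in> S" "q \<notin> S"
  obtains j i where "(j, i) \<in> E" "j \<in> S" "i \<notin> S"
proof -
  have "\<not> E `` S \<subseteq> S"
    using Image_closed_trancl[of E S] assms unfolding strongly_connected_def by blast
  then show ?thesis using that by blast
qed

text \<open>Pigeonhole principle: if every point of \<open>S\<close> below \<open>q\<close> had
  another point of \<open>S\<close> less than \<open>\<gamma>\<close> above it, one could climb from
  \<open>p\<close> to \<open>q\<close> by steps shorter than \<open>\<gamma>\<close>. Each step uses
  up a point of \<open>S\<close> other than \<open>p\<close>, so there are fewer than
  \<open>card S\<close> steps, too few for the distance \<open>q - p\<close>.\<close>

lemma finite_gap:
  fixes S :: "real set" and p q \<gamma> :: real
  assumes "finite S" "p \<in> S" "q \<in> S" "\<gamma> > 0" "q - p \<ge> card S * \<gamma>"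
  obtains \<alpha> where "\<alpha> \<in> S" "\<And>z. z \<in> S \<Longrightarrow> z \<le> \<alpha> \<or> \<alpha> + \<gamma> \<le> z" "\<alpha> < q"
proof -
  have "q - p < card S * \<gamma>" if no: "\<not> (\<exists>\<alpha>\<in>S. \<alpha> < q \<and> (\<forall>z\<in>S. z \<le> \<alpha> \<or> \<alpha> + \<gamma> \<le> z))"
  proof -
    \<comment> \<open>Induction on the number of points in the half-open interval above
      \<open>p\<close>, which drops with each step. A last step that overshoots \<open>q\<close> is
      paid for by \<open>q\<close> itself.\<close>
    have "q - p \<le> card {z\<in>S. p < z \<and> z \<le> q} * \<gamma>" if "p \<in> S" "p \<le> q" for p
      using that
    proof (induction "card {z\<in>S. p < z \<and> z \<le> q}" arbitrary: p rule: less_induct)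
      case less
      show ?case
      proof (cases "p = q")
        case False
        with less.prems no obtain z where z: "z \<in> S" "p < z" "z < p + \<gamma>"
          by force
        show ?thesis
        proof (cases "z \<le> q")
          case True
          have "{y\<in>S. z < y \<and> y \<le> q} \<subset> {y\<in>S. p < y \<and> y \<le> q}"
            using z True by auto
          then have c: "card {y\<in>S. z < y \<and> y \<le> q} < card {y\<in>S. p < y \<and> y \<le> q}"
            using assms(1) by (intro psubset_card_mono) auto
          have "q - z \<le> card {y\<in>S. z < y \<and> y \<le> q} * \<gamma>"
            using less.hyps[OF c z(1) True] .
          moreover have "real (card {y\<in>S. z < y \<and> y \<le> q} + 1) * \<gamma> \<le> card {y\<in>S. p < y \<and> y \<le> q} * \<gamma>"
            using c assms(4) by (intro mult_right_mono) auto
          ultimately show ?thesis using z by (simp add: algebra_simps)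
        next
          case False
          have "q \<in> {y\<in>S. p < y \<and> y \<le> q}"
            using assms less.prems \<open>p \<noteq> q\<close> by auto
          then have "1 \<le> card {y\<in>S. p < y \<and> y \<le> q}"
            using assms(1) by (metis (no_types, lifting) One_nat_def Suc_leI card_gt_0_iff empty_iff finite_Collect_conjI finite.emptyI finite_subset mem_Collect_eq subsetI)
          then have "1 * \<gamma> \<le> card {y\<in>S. p < y \<and> y \<le> q} * \<gamma>"
            using assms(4) by (intro mult_right_mono) auto
          then show ?thesis using z False by linarith
        qed
      qed (use assms(4) in simp)
    qed
    moreover have "p \<le> q"
      using assms by (smt (verit) mult_nonneg_nonneg of_nat_0_le_iff)
    moreover have "{z\<in>S. p < z \<and> z \<le> q} \<subset> S" using assms by auto
    then have "card {z\<in>S. p < z \<and> z \<le> q} < card S"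
      using assms(1) by (rule psubset_card_mono[rotated])
    then have "card {z\<in>S. p < z \<and> z \<le> q} * \<gamma> < card S * \<gamma>" using assms(4) by simp
    ultimately show ?thesis using assms(2) by fastforce
  qed
  then show ?thesis using that assms(5) by (meson not_le)
qed

text \<open>Swapping the order of summation turns the weight of \<open>u j\<close> into a column
  sum, which balance equates with the row sum. So the coupling alone never changes a total over the
  agents to first order; this is used for the bumps and for the squared distances.\<close>

lemma balanced_sum_diff:
  fixes A :: "'i::finite \<Rightarrow> 'i \<Rightarrow> real"
  assumes "\<And>i. (\<Sum>j\<in>UNIV. A i j) = (\<Sum>j\<in>UNIV. A j i)"
  shows "(\<Sum>i\<in>UNIV. \<Sum>j\<in>UNIV. A i j * (u j - u i)) = 0"
proof -
  have "(\<Sum>i\<in>UNIV. \<Sum>j\<in>UNIV. A i j * u j) = (\<Sum>j\<in>UNIV. \<Sum>i\<in>UNIV. A i j * u j)"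
    by (rule sum.swap)
  also have "\<dots> = (\<Sum>j\<in>UNIV. \<Sum>i\<in>UNIV. A j i * u j)"
    by (simp add: assms flip: sum_distrib_right)
  finally show ?thesis by (simp add: right_diff_distrib sum_subtractf)
qed

section \<open>A semiconvex bump supported in a gap\<close>

text \<open>The parabola is positive exactly strictly between its zeros \<open>\<alpha>\<close> and
  \<open>\<alpha> + \<gamma>\<close> (for positive \<open>\<gamma>\<close>). Squaring its positive
  part smooths the corners there, so that the bump is continuously differentiable.\<close>

definition bump :: "real \<Rightarrow> real \<Rightarrow> real \<Rightarrow> real" where
  "bump \<alpha> \<gamma> y = (max 0 ((y - \<alpha>) * (\<alpha> + \<gamma> - y)))\<^sup>2"

definition bump' :: "real \<Rightarrow> real \<Rightarrow> real \<Rightarrow> real" where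
  "bump' \<alpha> \<gamma> y = 2 * max 0 ((y - \<alpha>) * (\<alpha> + \<gamma> - y)) * (2 * \<alpha> + \<gamma> - 2 * y)"

lemma bump_nonneg: "0 \<le> bump \<alpha> \<gamma> y"
  by (simp add: bump_def)

lemma bump_eq_0:
  assumes "\<gamma> > 0" "y \<le> \<alpha> \<or> \<alpha> + \<gamma> \<le> y"
  shows "bump \<alpha> \<gamma> y = 0"
proof -
  have "(y - \<alpha>) * (\<alpha> + \<gamma> - y) \<le> 0"
    using assms by (auto simp: mult_le_0_iff)
  then show ?thesis by (simp add: bump_def)
qed

text \<open>The two third points serve as barriers: as long as the bump stays below this height, a
  continuous path cannot pass them.\<close>

lemma bump_thirds:
  assumes "y = \<alpha> + \<gamma> / 3 \<or> y = \<alpha> + 2 * \<gamma> / 3"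
  shows "bump \<alpha> \<gamma> y = 4 * \<gamma>^4 / 81"
proof -
  have "(y - \<alpha>) * (\<alpha> + \<gamma> - y) = 2 * \<gamma>\<^sup>2 / 9"
    using assms by (elim disjE) (simp_all only:, simp_all add: field_simps power2_eq_square)
  moreover have "0 \<le> 2 * \<gamma>\<^sup>2 / 9" by simp
  ultimately have "bump \<alpha> \<gamma> y = (2 * \<gamma>\<^sup>2 / 9)\<^sup>2"
    unfolding bump_def by (simp only: max_def if_True)
  then show ?thesis by (simp add: power_divide power_mult_distrib)
qed

lemma bump_hat_le: "max 0 ((y - \<alpha>) * (\<alpha> + \<gamma> - y)) \<le> \<gamma>\<^sup>2 / 4" for y :: real
proof -
  have "0 \<le> (y - \<alpha> - \<gamma> / 2)\<^sup>2" by simp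
  then have "(y - \<alpha>) * (\<alpha> + \<gamma> - y) \<le> \<gamma>\<^sup>2 / 4"
    by (simp add: field_simps power2_eq_square)
  then show ?thesis by (simp only: max.bounded_iff) simp
qed

lemma bump_deriv: "(bump \<alpha> \<gamma> has_real_derivative bump' \<alpha> \<gamma> y) (at y)"
proof -
  \<comment> \<open>\<open>max 0 u\<close> has a corner at 0, but its square is differentiable; the
    difference quotient misses the derivative by at most \<open>\<bar>h\<bar>\<close>.\<close>
  have sq: "((\<lambda>u::real. (max 0 u)\<^sup>2) has_real_derivative 2 * max 0 u) (at u)" for u
    unfolding DERIV_def
  proof (rule LIM_zero_cancel, rule Lim_null_comparison)
    show "((\<lambda>h. \<bar>h\<bar>) \<longlongrightarrow> 0) (at (0::real))"
      by (rule tendsto_eq_intros | simp)+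
    have "\<bar>((max 0 (u + h))\<^sup>2 - (max 0 u)\<^sup>2) / h - 2 * max 0 u\<bar> \<le> \<bar>h\<bar>" if "h \<noteq> 0" for h
    proof -
      \<comment> \<open>The lower bound reflects convexity of the squared positive part, the upper
        bound the fact that its derivative has Lipschitz constant 2.\<close>
      have "0 \<le> (max 0 (u + h))\<^sup>2 - (max 0 u)\<^sup>2 - 2 * max 0 u * h \<and>
        (max 0 (u + h))\<^sup>2 - (max 0 u)\<^sup>2 - 2 * max 0 u * h \<le> h\<^sup>2"
      proof (cases "u \<le> 0")
        case True
        then have "(max 0 (u + h))\<^sup>2 \<le> \<bar>h\<bar>\<^sup>2"
          by (intro power_mono) auto
        then show ?thesis using True by simp
      next
        case False
        then have m: "max 0 u = u" by simp
        show ?thesis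
        proof (cases "u + h \<le> 0")
          case True
          then have "0 \<le> u * (- u - 2 * h)" using False by (intro mult_nonneg_nonneg) linarith+
          moreover have "0 \<le> (u + h)\<^sup>2" by simp
          moreover have "max 0 (u + h) = 0" using True by simp
          ultimately show ?thesis unfolding m by (simp add: power2_eq_square algebra_simps)
        next
          case False
          then have "max 0 (u + h) = u + h" by simp
          then show ?thesis unfolding m by (simp add: power2_eq_square algebra_simps)
        qed
      qed
      then have "\<bar>(max 0 (u + h))\<^sup>2 - (max 0 u)\<^sup>2 - 2 * max 0 u * h\<bar> / \<bar>h\<bar> \<le> h\<^sup>2 / \<bar>h\<bar>"
        by (intro divide_right_mono) auto
      also have "h\<^sup>2 / \<bar>h\<bar> = \<bar>h\<bar>" using that by (simp add: power2_eq_square abs_if)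
      also have "\<bar>(max 0 (u + h))\<^sup>2 - (max 0 u)\<^sup>2 - 2 * max 0 u * h\<bar> / \<bar>h\<bar> =
          \<bar>((max 0 (u + h))\<^sup>2 - (max 0 u)\<^sup>2 - 2 * max 0 u * h) / h\<bar>"
        by (rule abs_divide[symmetric])
      also have "((max 0 (u + h))\<^sup>2 - (max 0 u)\<^sup>2 - 2 * max 0 u * h) / h =
          ((max 0 (u + h))\<^sup>2 - (max 0 u)\<^sup>2) / h - 2 * max 0 u"
        using nonzero_mult_div_cancel_right[OF that] by (simp only: diff_divide_distrib)
      finally show ?thesis .
    qed
    then show "\<forall>\<^sub>F h in at 0. norm (((max 0 (u + h))\<^sup>2 - (max 0 u)\<^sup>2) / h - 2 * max 0 u) \<le> \<bar>h\<bar>"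
      by (auto simp: eventually_at_filter)
  qed
  show ?thesis
    unfolding bump_def[abs_def] bump'_def
    by (rule DERIV_chain2[OF sq, THEN DERIV_cong]) (auto intro!: derivative_eq_intros)
qed

lemma bump'_cont: "continuous_on UNIV (bump' \<alpha> \<gamma>)"
  unfolding bump'_def[abs_def] by (intro continuous_intros)

lemma bump'_bound:
  assumes "\<gamma> > 0"
  shows "\<bar>bump' \<alpha> \<gamma> y\<bar> \<le> \<gamma>^3 / 2"
proof (cases "y \<le> \<alpha> \<or> \<alpha> + \<gamma> \<le> y")
  case True
  then have "(y - \<alpha>) * (\<alpha> + \<gamma> - y) \<le> 0"
    using assms by (auto simp: mult_le_0_iff)
  then show ?thesis using assms by (simp add: bump'_def)
next
  case False
  have "2 * max 0 ((y - \<alpha>) * (\<alpha> + \<gamma> - y)) * \<bar>2 * \<alpha> + \<gamma> - 2 * y\<bar> \<le> 2 * (\<gamma>\<^sup>2 / 4) * \<gamma>"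
    using False by (intro mult_mono bump_hat_le mult_nonneg_nonneg) auto
  then show ?thesis by (simp add: bump'_def abs_mult power3_eq_cube power2_eq_square)
qed

text \<open>The parabola at \<open>w\<close> equals its tangent from \<open>y\<close> minus
  \<open>(w - y)\<^sup>2\<close>, and squaring the positive part is convex and increasing. The loss
  of convexity is therefore \<open>(w - y)\<^sup>2\<close> times twice the height at
  \<open>y\<close>, which is at most \<open>\<gamma>\<^sup>2 / 2\<close>. Weighted by
  \<open>a\<close>, this correction becomes a multiple of the dissipation.\<close>

lemma bump_semiconvex:
  "bump' \<alpha> \<gamma> y * (w - y) \<le> bump \<alpha> \<gamma> w - bump \<alpha> \<gamma> y + \<gamma>\<^sup>2 / 2 * (w - y)\<^sup>2"
proof -
  define q where "q = (\<lambda>y. (y - \<alpha>) * (\<alpha> + \<gamma> - y))"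
  define p where "p = max 0 (q y)"
  have p: "0 \<le> p" "p \<le> \<gamma>\<^sup>2 / 4" using bump_hat_le by (auto simp: p_def q_def)
  have "2 * p * (max 0 (q w) - p) \<ge> 2 * p * ((2 * \<alpha> + \<gamma> - 2 * y) * (w - y) - (w - y)\<^sup>2)"
  proof (cases "q y > 0")
    case True
    have "q w - q y = (2 * \<alpha> + \<gamma> - 2 * y) * (w - y) - (w - y)\<^sup>2"
      by (simp add: q_def algebra_simps power2_eq_square)
    then show ?thesis using True by (intro mult_left_mono) (auto simp: p_def)
  qed (simp add: p_def)
  then have "2 * p * (2 * \<alpha> + \<gamma> - 2 * y) * (w - y) \<le> 2 * p * max 0 (q w) - 2 * p * p + 2 * p * (w - y)\<^sup>2"
    by (simp add: algebra_simps)
  moreover have "2 * p * (w - y)\<^sup>2 \<le> \<gamma>\<^sup>2 / 2 * (w - y)\<^sup>2"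
    using p by (intro mult_right_mono) auto
  moreover have "2 * p * max 0 (q w) - 2 * p * p \<le> (max 0 (q w))\<^sup>2 - p\<^sup>2"
    using sum_squares_bound[of p "max 0 (q w)"] by (simp add: power2_eq_square)
  moreover have "bump \<alpha> \<gamma> w = (max 0 (q w))\<^sup>2" "bump \<alpha> \<gamma> y = p\<^sup>2"
    "bump' \<alpha> \<gamma> y = 2 * p * (2 * \<alpha> + \<gamma> - 2 * y)"
    by (simp_all add: bump_def bump'_def p_def q_def)
  ultimately show ?thesis by simp
qed

section \<open>A persistent gap forces dissipation\<close>

text \<open>\<open>z\<close> stands for one coordinate of the states, \<open>w\<close> for that
  coordinate of the perturbation, and \<open>d\<close> for an integrable majorant of the
  dissipation, later the negative energy rate. By \<open>small1\<close> the total bump stays below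
  the height at the third points, so the two groups of agents remain at least
  \<open>\<gamma> / 3\<close> apart. An edge between the groups then dissipates more than
  \<open>small2\<close> permits.\<close>

lemma no_gap_if_small_dissipation:
  fixes A :: "'i::finite \<Rightarrow> 'i \<Rightarrow> real \<Rightarrow> real" and z f w :: "'i \<Rightarrow> real \<Rightarrow> real"
    and s T \<gamma> \<epsilon> \<delta> \<eta> \<alpha> :: real
  assumes T: "0 < T" and \<gamma>: "0 < \<gamma>" and \<epsilon>: "0 \<le> \<epsilon>"
    and A: "\<And>i j r. 0 \<le> A i j r"
    and balanced: "\<And>i r. r \<in> {s..s+T} \<Longrightarrow> (\<Sum>j\<in>UNIV. A i j r) = (\<Sum>j\<in>UNIV. A j i r)"
    and f: "\<And>i. f i absolutely_integrable_on {s..s+T}"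
    and z: "\<And>i r. r \<in> {s..s+T} \<Longrightarrow> (f i has_integral (z i r - z i s)) {s..r}"
    and dyn: "\<And>i r. r \<in> {s..s+T} \<Longrightarrow> f i r = (\<Sum>j\<in>UNIV. A i j r * (z j r - z i r)) + w i r"
    and w: "\<And>i r. r \<in> {s..s+T} \<Longrightarrow> \<bar>w i r\<bar> \<le> \<epsilon>"
    and d: "d integrable_on {s..s+T}" and d\<eta>: "integral {s..s+T} d \<le> \<eta>"
    and diss: "\<And>r. r \<in> {s..s+T} \<Longrightarrow> (\<Sum>i\<in>UNIV. \<Sum>j\<in>UNIV. A i j r * (z j r - z i r)\<^sup>2) \<le> d r"
    and conn: "\<And>L. L \<noteq> {} \<Longrightarrow> L \<noteq> UNIV \<Longrightarrow> \<exists>j\<in>L. \<exists>i\<in>-L. \<delta> \<le> integral {s..s+T} (A i j)"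
    and \<delta>: "0 < \<delta>"
    and small1: "\<gamma>\<^sup>2 / 2 * \<eta> + CARD('i) * (\<gamma>^3 / 2 * \<epsilon>) * T < 4 * \<gamma>^4 / 81"
    and small2: "\<eta> < \<delta> * (\<gamma> / 3)\<^sup>2"
    and gap: "\<And>i. z i s \<le> \<alpha> \<or> \<alpha> + \<gamma> \<le> z i s"
    and p: "z p s \<le> \<alpha>" and q: "\<alpha> < z q s"
  shows False
proof -
  have d0: "0 \<le> d r" if "r \<in> {s..s+T}" for r
    using diss[OF that] A by (meson mult_nonneg_nonneg order_trans sum_nonneg zero_le_power2)
  have zc: "continuous_on {s..s+T} (z i)" for i
    using T by (intro continuous_on_indefinite_integral[OF _ z]) auto
  define c where "c = CARD('i) * (\<gamma>^3 / 2 * \<epsilon>)"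
  have c0: "c \<ge> 0" using \<gamma> \<epsilon> by (simp add: c_def)
  \<comment> \<open>Semiconvexity bounds the coupling by differences of bumps, which balance
    cancels, plus the quadratic correction. Each agent's perturbation adds at most
    \<open>\<gamma>^3 / 2 * \<epsilon>\<close>.\<close>
  have pointwise: "(\<Sum>i\<in>UNIV. bump' \<alpha> \<gamma> (z i u) * f i u) \<le> \<gamma>\<^sup>2 / 2 * d u + c"
    if u: "u \<in> {s..s+T}" for u
  proof -
    have "(\<Sum>i\<in>UNIV. \<Sum>j\<in>UNIV. A i j u * (bump' \<alpha> \<gamma> (z i u) * (z j u - z i u))) \<le>
      (\<Sum>i\<in>UNIV. \<Sum>j\<in>UNIV. A i j u * (bump \<alpha> \<gamma> (z j u) - bump \<alpha> \<gamma> (z i u) + \<gamma>\<^sup>2 / 2 * (z j u - z i u)\<^sup>2))"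
      by (intro sum_mono mult_left_mono bump_semiconvex A)
    also have "\<dots> = (\<Sum>i\<in>UNIV. \<Sum>j\<in>UNIV. A i j u * (bump \<alpha> \<gamma> (z j u) - bump \<alpha> \<gamma> (z i u)))
        + \<gamma>\<^sup>2 / 2 * (\<Sum>i\<in>UNIV. \<Sum>j\<in>UNIV. A i j u * (z j u - z i u)\<^sup>2)"
      by (simp add: distrib_left sum.distrib sum_distrib_left mult_ac)
    also have "\<dots> \<le> \<gamma>\<^sup>2 / 2 * d u"
      using balanced_sum_diff[of "\<lambda>i j. A i j u" "\<lambda>i. bump \<alpha> \<gamma> (z i u)"] balanced[OF u]
        mult_left_mono[OF diss[OF u], of "\<gamma>\<^sup>2 / 2"] by simp
    finally have semi: "(\<Sum>i\<in>UNIV. \<Sum>j\<in>UNIV. A i j u * (bump' \<alpha> \<gamma> (z i u) * (z j u - z i u))) \<le> \<gamma>\<^sup>2 / 2 * d u" .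
    have "(\<Sum>i\<in>UNIV. bump' \<alpha> \<gamma> (z i u) * f i u) =
      (\<Sum>i\<in>UNIV. \<Sum>j\<in>UNIV. A i j u * (bump' \<alpha> \<gamma> (z i u) * (z j u - z i u))) + (\<Sum>i\<in>UNIV. bump' \<alpha> \<gamma> (z i u) * w i u)"
      by (simp add: dyn[OF u] distrib_left sum.distrib sum_distrib_left mult_ac)
    moreover have "(\<Sum>i\<in>UNIV. bump' \<alpha> \<gamma> (z i u) * w i u) \<le> (\<Sum>i\<in>(UNIV::'i set). \<gamma>^3 / 2 * \<epsilon>)"
    proof (rule sum_mono)
      fix i
      have "\<bar>bump' \<alpha> \<gamma> (z i u)\<bar> * \<bar>w i u\<bar> \<le> \<gamma>^3 / 2 * \<epsilon>"
        using bump'_bound[OF \<gamma>] w[OF u] \<gamma> by (intro mult_mono) auto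
      then show "bump' \<alpha> \<gamma> (z i u) * w i u \<le> \<gamma>^3 / 2 * \<epsilon>"
        by (metis abs_le_iff abs_mult)
    qed
    ultimately show ?thesis using semi by (simp add: c_def)
  qed
  \<comment> \<open>At time \<open>s\<close> no agent lies inside the gap, so the total bump starts
    at 0 and only its growth counts.\<close>
  have small: "(\<Sum>i\<in>UNIV. bump \<alpha> \<gamma> (z i r)) < 4 * \<gamma>^4 / 81" if r: "r \<in> {s..s+T}" for r
  proof -
    have "((\<lambda>u. bump' \<alpha> \<gamma> (z i u) * f i u) has_integral bump \<alpha> \<gamma> (z i r) - bump \<alpha> \<gamma> (z i s)) {s..r}" for i
    proof (rule chain_rule_indefinite_integral[OF _ _ _ bump_deriv bump'_cont])
      show "f i absolutely_integrable_on {s..r}"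
        using r by (intro set_integrable_subset[OF f]) auto
      show "(f i has_integral z i t - z i s) {s..t}" if "t \<in> {s..r}" for t
        using that r by (intro z) auto
    qed (use r in auto)
    then have I1: "((\<lambda>u. \<Sum>i\<in>UNIV. bump' \<alpha> \<gamma> (z i u) * f i u) has_integral
        (\<Sum>i\<in>UNIV. bump \<alpha> \<gamma> (z i r) - bump \<alpha> \<gamma> (z i s))) {s..r}"
      by (intro has_integral_sum) auto
    have dr: "d integrable_on {s..r}"
      using r by (intro integrable_subinterval_real[OF d]) auto
    have I2: "((\<lambda>u. \<gamma>\<^sup>2 / 2 * d u + c) has_integral (\<gamma>\<^sup>2 / 2 * integral {s..r} d + (r - s) * c)) {s..r}"
      using r has_integral_const_real[of c s r]
      by (intro has_integral_add has_integral_mult_right integrable_integral dr) auto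
    have "(\<Sum>i\<in>UNIV. bump \<alpha> \<gamma> (z i r) - bump \<alpha> \<gamma> (z i s)) \<le> \<gamma>\<^sup>2 / 2 * integral {s..r} d + (r - s) * c"
      using r by (intro has_integral_le[OF I1 I2] pointwise) auto
    moreover have "(\<Sum>i\<in>UNIV. bump \<alpha> \<gamma> (z i r) - bump \<alpha> \<gamma> (z i s)) = (\<Sum>i\<in>UNIV. bump \<alpha> \<gamma> (z i r))"
      by (simp add: bump_eq_0[OF \<gamma> gap])
    moreover have "integral {s..r} d \<le> integral {s..s+T} d"
      using r d0 by (intro integral_subset_le dr d) auto
    then have "\<gamma>\<^sup>2 / 2 * integral {s..r} d \<le> \<gamma>\<^sup>2 / 2 * \<eta>"
      using d\<eta> by (intro mult_left_mono) auto
    moreover have "(r - s) * c \<le> c * T" using mult_right_mono[of "r - s" T c] r c0 by (simp add: mult.commute)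
    ultimately show ?thesis using small1[folded c_def] by linarith
  qed
  have avoid: "z i r \<noteq> y" if "r \<in> {s..s+T}" "y = \<alpha> + \<gamma> / 3 \<or> y = \<alpha> + 2 * \<gamma> / 3" for i r y
  proof
    assume "z i r = y"
    have "bump \<alpha> \<gamma> (z i r) \<le> (\<Sum>i\<in>UNIV. bump \<alpha> \<gamma> (z i r))"
      by (rule member_le_sum[where f = "\<lambda>i. bump \<alpha> \<gamma> (z i r)"]) (auto simp: bump_nonneg)
    then show False using small[OF that(1)] bump_thirds[OF that(2)] \<open>z i r = y\<close> by simp
  qed
  have stay_low: "z i r < \<alpha> + \<gamma> / 3" if "z i s \<le> \<alpha>" "r \<in> {s..s+T}" for i r
  proof (rule ccontr)
    assume "\<not> ?thesis"
    then have "\<exists>x\<ge>s. x \<le> r \<and> z i x = \<alpha> + \<gamma> / 3"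
      using that \<gamma> by (intro IVT' continuous_on_subset[OF zc]) auto
    then show False using avoid[of _ "\<alpha> + \<gamma> / 3" i] that by force
  qed
  have stay_high: "\<alpha> + 2 * \<gamma> / 3 < z i r" if "\<alpha> + \<gamma> \<le> z i s" "r \<in> {s..s+T}" for i r
  proof (rule ccontr)
    assume "\<not> ?thesis"
    then have "\<exists>x\<ge>s. x \<le> r \<and> z i x = \<alpha> + 2 * \<gamma> / 3"
      using that \<gamma> by (intro IVT2' continuous_on_subset[OF zc]) auto
    then show False using avoid[of _ "\<alpha> + 2 * \<gamma> / 3" i] that by force
  qed
  obtain j i where ji: "z j s \<le> \<alpha>" "\<not> z i s \<le> \<alpha>" "\<delta> \<le> integral {s..s+T} (A i j)"
  proof -
    let ?L = "{i. z i s \<le> \<alpha>}"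
    have "p \<in> ?L" "q \<notin> ?L" using p q by auto
    then have "?L \<noteq> {}" "?L \<noteq> UNIV" by blast+
    from conn[OF this] show ?thesis using that by blast
  qed
  then have hi: "\<alpha> + \<gamma> \<le> z i s" using gap by blast
  \<comment> \<open>A non-integrable function has integral 0 by convention, so the positive lower
    bound \<open>\<delta>\<close> forces integrability.\<close>
  have Ai: "A i j integrable_on {s..s+T}"
    using ji(3) \<delta> not_integrable_integral by fastforce
  have "\<delta> * (\<gamma> / 3)\<^sup>2 \<le> integral {s..s+T} (A i j) * (\<gamma> / 3)\<^sup>2"
    using ji(3) by (intro mult_right_mono) auto
  also have "\<dots> = integral {s..s+T} (\<lambda>r. A i j r * (\<gamma> / 3)\<^sup>2)" by simp
  also have "\<dots> \<le> integral {s..s+T} d"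
  proof (rule integral_le[OF _ d])
    show "(\<lambda>r. A i j r * (\<gamma> / 3)\<^sup>2) integrable_on {s..s+T}"
      using Ai by (rule integrable_on_mult_left)
    fix r assume r: "r \<in> {s..s+T}"
    have "\<gamma> / 3 \<le> z i r - z j r"
      using stay_low[OF ji(1) r] stay_high[OF hi r] by (simp add: field_simps)
    then have "(\<gamma> / 3)\<^sup>2 \<le> (z j r - z i r)\<^sup>2"
      using \<gamma> by (subst power2_commute) (intro power_mono, auto)
    then have "A i j r * (\<gamma> / 3)\<^sup>2 \<le> A i j r * (z j r - z i r)\<^sup>2"
      by (intro mult_left_mono A)
    also have "\<dots> \<le> (\<Sum>j\<in>UNIV. A i j r * (z j r - z i r)\<^sup>2)"
      by (rule member_le_sum[where f = "\<lambda>j. A i j r * (z j r - z i r)\<^sup>2"]) (auto simp: A)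
    also have "\<dots> \<le> (\<Sum>i\<in>UNIV. \<Sum>j\<in>UNIV. A i j r * (z j r - z i r)\<^sup>2)"
      by (rule member_le_sum[where f="\<lambda>i. \<Sum>j\<in>UNIV. A i j r * (z j r - z i r)\<^sup>2"]) (auto simp: A intro!: sum_nonneg)
    also have "\<dots> \<le> d r" by (rule diss[OF r])
    finally show "A i j r * (\<gamma> / 3)\<^sup>2 \<le> d r" .
  qed
  finally show False using d\<eta> small2 by simp
qed

section \<open>Energy decay along the flow\<close>

text \<open>Both parts of \<open>phi\<close> pull towards a feasible point \<open>xs\<close>. The
  obtuse angle at the projection yields the squared distance to \<open>X i\<close>; the subgradient
  inequality tested at \<open>xs\<close>, where \<open>g i\<close> is nonpositive, yields the
  positive part of \<open>g i\<close>.\<close>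

lemma inner_phi_le:
  fixes X :: "'i \<Rightarrow> 'a::euclidean_space set"
  assumes "closed (X i)" "convex (X i)" "xs \<in> X i" "g i xs \<le> 0" "0 < \<tau>"
    and feas: "g i (x i t) \<le> 0 \<Longrightarrow> dg i (x i t) = 0"
    and sub: "g i (x i t) > 0 \<Longrightarrow> is_subgradient (g i) (x i t) (dg i (x i t))"
  shows "(x i t - xs) \<bullet> phi \<tau> X dg x i t
    \<le> - \<tau> * ((norm (x i t - closest_point (X i) (x i t)))\<^sup>2 + max 0 (g i (x i t)))"
proof -
  define y P where "y = x i t" and "P = closest_point (X i) y"
  have "(y - P) \<bullet> (xs - P) \<le> 0"
    unfolding P_def using assms by (intro closest_point_dot) auto
  then have "(norm (y - P))\<^sup>2 \<le> (y - xs) \<bullet> (y - P)"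
    by (simp add: power2_norm_eq_inner inner_diff_left inner_diff_right inner_commute)
  moreover have "max 0 (g i y) \<le> (y - xs) \<bullet> dg i y"
  proof (cases "g i y \<le> 0")
    case False
    then have "g i y + dg i y \<bullet> (xs - y) \<le> g i xs"
      using sub unfolding y_def is_subgradient_def by auto
    then show ?thesis using False assms(4) by (simp add: inner_diff_left inner_diff_right inner_commute)
  qed (use feas in \<open>simp add: y_def\<close>)
  ultimately have "(norm (y - P))\<^sup>2 + max 0 (g i y) \<le> (y - xs) \<bullet> (y - P + dg i y)"
    unfolding inner_add_right by linarith
  then have "\<tau> * ((norm (y - P))\<^sup>2 + max 0 (g i y)) \<le> \<tau> * ((y - xs) \<bullet> (y - P + dg i y))"
    using assms(5) by (intro mult_left_mono) auto
  then show ?thesis unfolding phi_def y_def P_def by simp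
qed

locale cfp_flow =
  fixes g :: "'i::finite \<Rightarrow> 'a::euclidean_space \<Rightarrow> real"
    and X :: "'i \<Rightarrow> 'a set"
    and dg :: "'i \<Rightarrow> 'a \<Rightarrow> 'a"
    and a :: "'i \<Rightarrow> 'i \<Rightarrow> real \<Rightarrow> real"
    and x :: "'i \<Rightarrow> real \<Rightarrow> 'a"
    and \<tau> \<delta> T :: real
  assumes g_cont: "\<And>i. continuous_on UNIV (g i)"
    and X_closed: "\<And>i. closed (X i)"
    and X_convex: "\<And>i. convex (X i)"
    and dg_feas: "\<And>i z. g i z \<le> 0 \<Longrightarrow> dg i z = 0"
    and dg_subgrad: "\<And>i z. g i z > 0 \<Longrightarrow> is_subgradient (g i) z (dg i z)"
    and a_nonneg: "\<And>i j t. 0 \<le> a i j t"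
    and nonempty: "cfp_solutions g X \<noteq> {}"
    and balanced: "\<And>i t. 0 \<le> t \<Longrightarrow> (\<Sum>j\<in>UNIV. a i j t) = (\<Sum>j\<in>UNIV. a j i t)"
    and T_pos: "0 < T" and \<delta>_pos: "0 < \<delta>"
    and connected: "strongly_connected (delta_edges a \<delta> T)"
    and \<tau>_pos: "0 < \<tau>"
    and sol: "is_solution a \<tau> X dg x"
    and phi_lim: "\<And>i. (phi \<tau> X dg x i \<longlongrightarrow> 0) at_top"
begin

abbreviation "rhs \<equiv> flow_rhs a \<tau> X dg x"
abbreviation "\<phi> \<equiv> phi \<tau> X dg x"

definition energy :: "'a \<Rightarrow> real \<Rightarrow> real" where
  "energy c t = (\<Sum>i\<in>UNIV. (norm (x i t - c))\<^sup>2)"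

text \<open>The formal time derivative of \<open>energy c\<close>, linked to it only in integrated
  form because the states are Caratheodory solutions.\<close>

definition energy_rate :: "'a \<Rightarrow> real \<Rightarrow> real" where
  "energy_rate c t = (\<Sum>i\<in>UNIV. 2 * ((x i t - c) \<bullet> rhs i t))"

lemma rhs_eq: "rhs i t = (\<Sum>j\<in>UNIV. a i j t *\<^sub>R (x j t - x i t)) + \<phi> i t"
proof -
  have "(\<Sum>j\<in>{j. 0 < a i j t}. a i j t *\<^sub>R (x j t - x i t)) = (\<Sum>j\<in>UNIV. a i j t *\<^sub>R (x j t - x i t))"
    using a_nonneg by (intro sum.mono_neutral_left) (auto simp: order.order_iff_strict)
  then show ?thesis by (simp add: flow_rhs_def)
qed

lemma rhs_absolutely_integrable: "0 \<le> s \<Longrightarrow> rhs i absolutely_integrable_on {s..t}"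
proof (cases "s \<le> t")
  case True
  assume "0 \<le> s"
  then have "rhs i absolutely_integrable_on {0..t}"
    using sol True unfolding is_solution_def by (metis order_trans)
  then show ?thesis
    by (rule set_integrable_subset) (use \<open>0 \<le> s\<close> in auto)
qed auto

lemma rhs_has_integral:
  assumes "0 \<le> s" "s \<le> t"
  shows "(rhs i has_integral (x i t - x i s)) {s..t}"
proof -
  have I: "(rhs i has_integral (x i u - x i 0)) {0..u}" if "0 \<le> u" for u
    using sol that unfolding is_solution_def by blast
  have "rhs i integrable_on {0..t}"
    using I[of t] assms by auto
  then have "integral {0..s} (rhs i) + integral {s..t} (rhs i) = integral {0..t} (rhs i)"
    by (intro Henstock_Kurzweil_Integration.integral_combine assms)
  moreover have "integral {0..s} (rhs i) = x i s - x i 0" "integral {0..t} (rhs i) = x i t - x i 0"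
    using I assms by (auto intro!: integral_unique)
  ultimately have "integral {s..t} (rhs i) = x i t - x i s" by (simp add: algebra_simps)
  moreover have "rhs i integrable_on {s..t}"
    using rhs_absolutely_integrable[OF assms(1)] set_lebesgue_integral_eq_integral(1) by blast
  ultimately show ?thesis by (metis integrable_integral)
qed

text \<open>The scalar chain rule is applied to the squared distance in each coordinate, and the
  results are summed over coordinates and agents.\<close>

lemma energy_has_integral:
  assumes "0 \<le> s" "s \<le> t"
  shows "(energy_rate c has_integral (energy c t - energy c s)) {s..t}"
proof -
  have comp: "((\<lambda>u. 2 * (x i u \<bullet> b - c \<bullet> b) * (rhs i u \<bullet> b)) has_integral
      (x i t \<bullet> b - c \<bullet> b)\<^sup>2 - (x i s \<bullet> b - c \<bullet> b)\<^sup>2) {s..t}" for i b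
  proof (rule chain_rule_indefinite_integral[where F' = "\<lambda>y. 2 * (y - c \<bullet> b)"])
    show "(\<lambda>u. rhs i u \<bullet> b) absolutely_integrable_on {s..t}"
      by (intro absolutely_integrable_component rhs_absolutely_integrable assms)
    show "((\<lambda>u. rhs i u \<bullet> b) has_integral x i r \<bullet> b - x i s \<bullet> b) {s..r}" if "r \<in> {s..t}" for r
      using has_integral_linear[OF rhs_has_integral[of s r i] bounded_linear_inner_left[of b]] that assms
      by (simp add: o_def inner_diff_left)
    show "((\<lambda>y. (y - c \<bullet> b)\<^sup>2) has_real_derivative 2 * (y - c \<bullet> b)) (at y)" for y
      by (auto intro!: derivative_eq_intros)
    show "continuous_on UNIV (\<lambda>y. 2 * (y - c \<bullet> b))"
      by (intro continuous_intros)
  qed (use assms in auto)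
  have "((\<lambda>u. \<Sum>i\<in>UNIV. \<Sum>b\<in>Basis. 2 * (x i u \<bullet> b - c \<bullet> b) * (rhs i u \<bullet> b)) has_integral
      (\<Sum>i\<in>UNIV. \<Sum>b\<in>Basis. (x i t \<bullet> b - c \<bullet> b)\<^sup>2 - (x i s \<bullet> b - c \<bullet> b)\<^sup>2)) {s..t}"
    by (intro has_integral_sum comp) auto
  moreover have "2 * ((x i u - c) \<bullet> rhs i u) = (\<Sum>b\<in>Basis. 2 * (x i u \<bullet> b - c \<bullet> b) * (rhs i u \<bullet> b))" for i u
    by (subst euclidean_inner) (simp only: sum_distrib_left inner_diff_left mult.assoc)
  then have "energy_rate c = (\<lambda>u. \<Sum>i\<in>UNIV. \<Sum>b\<in>Basis. 2 * (x i u \<bullet> b - c \<bullet> b) * (rhs i u \<bullet> b))"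
    unfolding energy_rate_def by presburger
  moreover have "(norm (x i u - c))\<^sup>2 = (\<Sum>b\<in>Basis. (x i u \<bullet> b - c \<bullet> b)\<^sup>2)" for i u
    unfolding power2_norm_eq_inner
    by (subst euclidean_inner) (simp add: inner_diff_left power2_eq_square)
  then have "energy c u = (\<Sum>i\<in>UNIV. \<Sum>b\<in>Basis. (x i u \<bullet> b - c \<bullet> b)\<^sup>2)" for u
    unfolding energy_def by simp
  ultimately show ?thesis by (simp add: sum_subtractf)
qed

lemma inner_phi:
  assumes "c \<in> cfp_solutions g X"
  shows "(x i t - c) \<bullet> \<phi> i t
    \<le> - \<tau> * ((norm (x i t - closest_point (X i) (x i t)))\<^sup>2 + max 0 (g i (x i t)))"
  using assms \<tau>_pos dg_feas dg_subgrad X_closed X_convex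
  by (intro inner_phi_le) (auto simp: cfp_solutions_def)

text \<open>Polarization splits each coupling term into a difference of squared distances to
  \<open>c\<close>, cancelled by balance, and minus the squared disagreement. The contribution of
  \<open>\<phi>\<close> is nonpositive because \<open>c\<close> is feasible.\<close>

lemma energy_rate_le:
  assumes c: "c \<in> cfp_solutions g X" and t: "0 \<le> t"
  shows "(\<Sum>i\<in>UNIV. \<Sum>j\<in>UNIV. a i j t * (norm (x j t - x i t))\<^sup>2) \<le> - energy_rate c t"
proof -
  have "2 * ((x i t - c) \<bullet> (x j t - x i t)) =
      (norm (x j t - c))\<^sup>2 - (norm (x i t - c))\<^sup>2 - (norm (x j t - x i t))\<^sup>2" for i j
    by (simp add: power2_norm_eq_inner inner_diff_left inner_diff_right inner_commute)
  then have "2 * (a i j t * ((x i t - c) \<bullet> (x j t - x i t))) =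
      a i j t * ((norm (x j t - c))\<^sup>2 - (norm (x i t - c))\<^sup>2) - a i j t * (norm (x j t - x i t))\<^sup>2" for i j
    by (metis mult.left_commute right_diff_distrib)
  then have "energy_rate c t =
      (\<Sum>i\<in>UNIV. \<Sum>j\<in>UNIV. a i j t * ((norm (x j t - c))\<^sup>2 - (norm (x i t - c))\<^sup>2))
      - (\<Sum>i\<in>UNIV. \<Sum>j\<in>UNIV. a i j t * (norm (x j t - x i t))\<^sup>2)
      + (\<Sum>i\<in>UNIV. 2 * ((x i t - c) \<bullet> \<phi> i t))"
    unfolding energy_rate_def rhs_eq
    by (simp add: inner_add_right inner_sum_right distrib_left sum_distrib_left sum.distrib sum_subtractf)
  moreover have "(\<Sum>i\<in>UNIV. \<Sum>j\<in>UNIV. a i j t * ((norm (x j t - c))\<^sup>2 - (norm (x i t - c))\<^sup>2)) = 0"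
    by (rule balanced_sum_diff) (rule balanced[OF t])
  moreover have "(x i t - c) \<bullet> \<phi> i t \<le> 0" for i
  proof -
    have "0 \<le> \<tau> * ((norm (x i t - closest_point (X i) (x i t)))\<^sup>2 + max 0 (g i (x i t)))"
      using \<tau>_pos by (intro mult_nonneg_nonneg add_nonneg_nonneg) auto
    then show ?thesis using inner_phi[OF c, of i t] by linarith
  qed
  then have "(\<Sum>i\<in>UNIV. 2 * ((x i t - c) \<bullet> \<phi> i t)) \<le> 0"
    by (intro sum_nonpos) (simp add: mult_nonneg_nonpos)
  ultimately show ?thesis by linarith
qed

lemma energy_antimono:
  assumes c: "c \<in> cfp_solutions g X" and "0 \<le> s" "s \<le> t"
  shows "energy c t \<le> energy c s"
proof -
  have "energy c t - energy c s \<le> 0"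
  proof (rule has_integral_le[OF energy_has_integral[OF assms(2,3)] has_integral_0])
    fix u assume "u \<in> {s..t}"
    then have "(\<Sum>i\<in>UNIV. \<Sum>j\<in>UNIV. a i j u * (norm (x j u - x i u))\<^sup>2) \<le> - energy_rate c u"
      using assms by (intro energy_rate_le) auto
    moreover have "0 \<le> (\<Sum>i\<in>UNIV. \<Sum>j\<in>UNIV. a i j u * (norm (x j u - x i u))\<^sup>2)"
      using a_nonneg by (intro sum_nonneg mult_nonneg_nonneg) auto
    ultimately show "energy_rate c u \<le> 0" by linarith
  qed
  then show ?thesis by simp
qed

lemma norm_le_energy: "(norm (x i t - c))\<^sup>2 \<le> energy c t"
  unfolding energy_def by (rule member_le_sum) auto

lemma norm_le_initial_energy:
  assumes "c \<in> cfp_solutions g X" "0 \<le> t"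
  shows "norm (x i t - c) \<le> sqrt (energy c 0)"
  using norm_le_energy[of i t c] energy_antimono[OF assms(1) _ assms(2)] real_le_rsqrt by force

text \<open>The energy decreases and is bounded below. Once it is within \<open>\<eta>\<close> of
  its infimum, no later drop can exceed \<open>\<eta>\<close>.\<close>

lemma eventually_energy_drop_small:
  assumes c: "c \<in> cfp_solutions g X" and "0 < \<eta>"
  shows "\<forall>\<^sub>F s in at_top. energy c s - energy c (s + T) \<le> \<eta>"
proof -
  define l where "l = Inf (energy c ` {0..})"
  have bdd: "bdd_below (energy c ` {0..})"
    by (rule bdd_belowI[of _ 0]) (auto simp: energy_def intro!: sum_nonneg)
  have "\<exists>y\<in>energy c ` {0..}. y < l + \<eta>"
    unfolding l_def using assms bdd by (subst cInf_less_iff[symmetric]) auto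
  then obtain s0 where s0: "0 \<le> s0" "energy c s0 < l + \<eta>" by auto
  have "energy c s - energy c (s + T) \<le> \<eta>" if "s0 \<le> s" for s
  proof -
    have "l \<le> energy c (s + T)"
      unfolding l_def using s0 that T_pos by (intro cInf_lower bdd) auto
    then show ?thesis using energy_antimono[OF c s0(1) that] s0(2) by simp
  qed
  then show ?thesis by (auto simp: eventually_at_top_linorder)
qed

section \<open>Consensus, one coordinate at a time\<close>

text \<open>If the spread at a late time were at least \<open>e\<close>, the at most
  \<open>n\<close> values of the coordinate would leave a gap of length \<open>e / n\<close>, which
  small dissipation over the next window rules out.\<close>

lemma coordinate_consensus:
  assumes b: "b \<in> Basis" and e: "0 < e"
  shows "\<forall>\<^sub>F s in at_top. \<forall>p q. x q s \<bullet> b - x p s \<bullet> b < e"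
proof -
  obtain c where c: "c \<in> cfp_solutions g X" using nonempty by blast
  define n where "n = real CARD('i)"
  have n: "0 < n" by (simp add: n_def)
  define \<gamma> where "\<gamma> = e / n"
  have \<gamma>: "0 < \<gamma>" using n e by (simp add: \<gamma>_def)
  \<comment> \<open>The constants make each of the two terms in \<open>small1\<close> at most
    \<open>\<gamma>^4 / 81\<close>, out of an allowance of four such units. The second entry of the
    minimum is half the bound in \<open>small2\<close>.\<close>
  define \<eta> where "\<eta> = min (2 * \<gamma>\<^sup>2 / 81) (\<delta> * \<gamma>\<^sup>2 / 18)"
  define \<epsilon> where "\<epsilon> = 2 * \<gamma> / (81 * n * T)"
  have \<eta>: "0 < \<eta>" and \<epsilon>: "0 < \<epsilon>" using \<gamma> \<delta>_pos T_pos n by (auto simp: \<eta>_def \<epsilon>_def)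
  have "\<forall>\<^sub>F s in at_top. \<forall>i. norm (\<phi> i s) < \<epsilon>"
    using phi_lim \<epsilon> by (intro eventually_all_finite) (simp add: tendsto_iff)
  then obtain s1 where s1: "norm (\<phi> i s) < \<epsilon>" if "s1 \<le> s" for i s
    by (auto simp: eventually_at_top_linorder)
  have small1: "\<gamma>\<^sup>2 / 2 * \<eta> + n * (\<gamma>^3 / 2 * \<epsilon>) * T < 4 * \<gamma>^4 / 81"
  proof -
    have "\<gamma>\<^sup>2 / 2 * \<eta> \<le> \<gamma>\<^sup>2 / 2 * (2 * \<gamma>\<^sup>2 / 81)"
      by (intro mult_left_mono) (auto simp: \<eta>_def)
    also have "\<dots> = \<gamma>^4 / 81" by (simp add: power4_eq_xxxx power2_eq_square)
    finally have "\<gamma>\<^sup>2 / 2 * \<eta> \<le> \<gamma>^4 / 81" .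
    moreover have "n * (\<gamma>^3 / 2 * \<epsilon>) * T = \<gamma>^4 / 81"
      using n T_pos by (simp add: \<epsilon>_def power4_eq_xxxx power3_eq_cube)
    moreover have "0 < \<gamma>^4" using \<gamma> by simp
    ultimately show ?thesis by linarith
  qed
  have small2: "\<eta> < \<delta> * (\<gamma> / 3)\<^sup>2"
  proof -
    have "\<eta> \<le> \<delta> * \<gamma>\<^sup>2 / 18" by (simp add: \<eta>_def)
    also have "\<dots> < \<delta> * (\<gamma> / 3)\<^sup>2" using \<gamma> \<delta>_pos by (simp add: power_divide)
    finally show ?thesis .
  qed
  show ?thesis
    using eventually_energy_drop_small[OF c \<eta>] eventually_ge_at_top[of s1] eventually_ge_at_top[of 0]
  proof eventually_elim
    case (elim s)
    show ?case
    proof (intro allI, rule ccontr)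
      fix p q assume pq: "\<not> x q s \<bullet> b - x p s \<bullet> b < e"
      let ?S = "range (\<lambda>i. x i s \<bullet> b)"
      have "card ?S * \<gamma> \<le> n * \<gamma>"
        unfolding n_def using \<gamma> card_image_le[of UNIV "\<lambda>i. x i s \<bullet> b"] by (intro mult_right_mono) auto
      also have "n * \<gamma> = e" using n by (simp add: \<gamma>_def)
      finally have "card ?S * \<gamma> \<le> x q s \<bullet> b - x p s \<bullet> b" using pq by simp
      then obtain \<alpha> where \<alpha>: "\<alpha> \<in> ?S" "\<And>z. z \<in> ?S \<Longrightarrow> z \<le> \<alpha> \<or> \<alpha> + \<gamma> \<le> z" "\<alpha> < x q s \<bullet> b"
        using finite_gap[of ?S "x p s \<bullet> b" "x q s \<bullet> b" \<gamma>] \<gamma> by auto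
      then obtain p' where p': "x p' s \<bullet> b = \<alpha>" by auto
      show False
      proof (rule no_gap_if_small_dissipation[where A = a and z = "\<lambda>i r. x i r \<bullet> b" and f = "\<lambda>i r. rhs i r \<bullet> b"
            and w = "\<lambda>i r. \<phi> i r \<bullet> b" and d = "\<lambda>r. - energy_rate c r" and s = s and p = p' and q = q])
        show "0 \<le> \<epsilon>" using \<epsilon> by simp
        show "(\<Sum>j\<in>UNIV. a i j r) = (\<Sum>j\<in>UNIV. a j i r)" if "r \<in> {s..s + T}" for i r
          using that elim by (intro balanced) auto
        show "(\<lambda>r. rhs i r \<bullet> b) absolutely_integrable_on {s..s + T}" for i
          using elim by (intro absolutely_integrable_component rhs_absolutely_integrable) auto
        show "((\<lambda>u. rhs i u \<bullet> b) has_integral x i r \<bullet> b - x i s \<bullet> b) {s..r}" if "r \<in> {s..s + T}" for i r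
          using has_integral_linear[OF rhs_has_integral[of s r i] bounded_linear_inner_left[of b]] that elim
          by (simp add: o_def inner_diff_left)
        show "rhs i r \<bullet> b = (\<Sum>j\<in>UNIV. a i j r * (x j r \<bullet> b - x i r \<bullet> b)) + \<phi> i r \<bullet> b" for i r
          by (simp add: rhs_eq inner_add_left inner_sum_left inner_diff_left)
        show "\<bar>\<phi> i r \<bullet> b\<bar> \<le> \<epsilon>" if "r \<in> {s..s + T}" for i r
          using Basis_le_norm[OF b, of "\<phi> i r"] s1[of r i] that elim by auto
        have I: "((\<lambda>r. - energy_rate c r) has_integral - (energy c (s + T) - energy c s)) {s..s + T}"
          using elim T_pos by (intro has_integral_neg energy_has_integral) auto
        then show "(\<lambda>r. - energy_rate c r) integrable_on {s..s + T}" by blast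
        show "integral {s..s + T} (\<lambda>r. - energy_rate c r) \<le> \<eta>"
          using integral_unique[OF I] elim by simp
        show "(\<Sum>i\<in>UNIV. \<Sum>j\<in>UNIV. a i j r * (x j r \<bullet> b - x i r \<bullet> b)\<^sup>2) \<le> - energy_rate c r"
          if "r \<in> {s..s + T}" for r
        proof -
          have "(x j r \<bullet> b - x i r \<bullet> b)\<^sup>2 \<le> (norm (x j r - x i r))\<^sup>2" for i j
            using Basis_le_norm[OF b, of "x j r - x i r"]
            by (simp add: abs_le_square_iff[symmetric] inner_diff_left)
          then have "(\<Sum>i\<in>UNIV. \<Sum>j\<in>UNIV. a i j r * (x j r \<bullet> b - x i r \<bullet> b)\<^sup>2)
              \<le> (\<Sum>i\<in>UNIV. \<Sum>j\<in>UNIV. a i j r * (norm (x j r - x i r))\<^sup>2)"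
            by (intro sum_mono mult_left_mono a_nonneg)
          also have "\<dots> \<le> - energy_rate c r"
            using that elim by (intro energy_rate_le c) auto
          finally show ?thesis .
        qed
        show "\<exists>j\<in>L. \<exists>i\<in>-L. \<delta> \<le> integral {s..s + T} (a i j)" if L: "L \<noteq> {}" "L \<noteq> UNIV" for L
        proof -
          from L obtain u v where "u \<in> L" "v \<notin> L" by blast
          then obtain j i where "(j, i) \<in> delta_edges a \<delta> T" "j \<in> L" "i \<notin> L"
            using strongly_connected_crossing_edge[OF connected] by metis
          then show ?thesis using elim by (auto simp: delta_edges_def)
        qed
        show "\<gamma>\<^sup>2 / 2 * \<eta> + CARD('i) * (\<gamma>^3 / 2 * \<epsilon>) * T < 4 * \<gamma>^4 / 81"
          using small1 by (simp add: n_def)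
      qed (use \<gamma> T_pos \<delta>_pos small2 \<alpha> p' a_nonneg in auto)
    qed
  qed
qed

lemma difference_tendsto_0: "((\<lambda>t. x i t - x j t) \<longlongrightarrow> 0) at_top"
proof (subst tendsto_componentwise_iff, intro ballI)
  fix b :: 'a assume b: "b \<in> Basis"
  show "((\<lambda>t. (x i t - x j t) \<bullet> b) \<longlongrightarrow> 0 \<bullet> b) at_top"
    unfolding tendsto_iff
  proof (intro allI impI)
    fix e :: real assume "0 < e"
    from coordinate_consensus[OF b this]
    show "\<forall>\<^sub>F t in at_top. dist ((x i t - x j t) \<bullet> b) (0 \<bullet> b) < e"
    proof eventually_elim
      case (elim s)
      then show ?case
        using elim[rule_format, of i j] elim[rule_format, of j i]
        by (simp add: inner_diff_left dist_real_def abs_less_iff)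
    qed
  qed
qed

section \<open>Feasibility and convergence of the trajectories\<close>

text \<open>The projection part and the subgradient part of \<open>\<phi>\<close> could cancel as
  vectors. Paired with \<open>x i t - c\<close> for a feasible \<open>c\<close>, they contribute
  with the same sign, so the vanishing of \<open>\<phi>\<close> and the boundedness of the states
  control both at once.\<close>

lemma residual_tendsto_0:
  "((\<lambda>t. (norm (x i t - closest_point (X i) (x i t)))\<^sup>2 + max 0 (g i (x i t))) \<longlongrightarrow> 0) at_top"
proof -
  obtain c where c: "c \<in> cfp_solutions g X" using nonempty by blast
  define R where "R = sqrt (energy c 0)"
  have bound: "(norm (x i t - closest_point (X i) (x i t)))\<^sup>2 + max 0 (g i (x i t)) \<le> R / \<tau> * norm (\<phi> i t)"
    if "0 \<le> t" for t
  proof -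
    have "\<tau> * ((norm (x i t - closest_point (X i) (x i t)))\<^sup>2 + max 0 (g i (x i t))) \<le> \<bar>(x i t - c) \<bullet> \<phi> i t\<bar>"
      using inner_phi[OF c, of i t] by linarith
    also have "\<dots> \<le> norm (x i t - c) * norm (\<phi> i t)" by (rule Cauchy_Schwarz_ineq2)
    also have "\<dots> \<le> R * norm (\<phi> i t)"
      unfolding R_def using norm_le_initial_energy[OF c that] by (intro mult_right_mono) auto
    finally show ?thesis using \<tau>_pos by (simp add: field_simps)
  qed
  show ?thesis
  proof (rule Lim_null_comparison)
    show "\<forall>\<^sub>F t in at_top. norm ((norm (x i t - closest_point (X i) (x i t)))\<^sup>2 + max 0 (g i (x i t)))
        \<le> R / \<tau> * norm (\<phi> i t)"
      using eventually_ge_at_top[of 0] by eventually_elim (use bound in simp)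
    show "((\<lambda>t. R / \<tau> * norm (\<phi> i t)) \<longlongrightarrow> 0) at_top"
      using phi_lim[of i] by (intro tendsto_mult_right_zero tendsto_norm_zero)
  qed
qed

text \<open>The residual tends to 0, so the projections onto the closed set \<open>X i\<close> have
  the same limit \<open>l\<close> as the states, and continuity of \<open>g i\<close> carries the
  inequality to \<open>l\<close>.\<close>

lemma limit_feasible:
  assumes "filterlim t at_top sequentially" and lim: "\<And>i. (\<lambda>n. x i (t n)) \<longlonglongrightarrow> l"
  shows "l \<in> cfp_solutions g X"
proof -
  have "g i l \<le> 0 \<and> l \<in> X i" for i
  proof -
    let ?P = "closest_point (X i)"
    have r: "(\<lambda>n. (norm (x i (t n) - ?P (x i (t n))))\<^sup>2 + max 0 (g i (x i (t n)))) \<longlonglongrightarrow> 0"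
      using filterlim_compose[OF residual_tendsto_0 assms(1)] .
    have "(\<lambda>n. max 0 (g i (x i (t n)))) \<longlonglongrightarrow> 0"
      by (rule Lim_null_comparison[OF _ r]) auto
    moreover have "(\<lambda>n. g i (x i (t n))) \<longlonglongrightarrow> g i l"
      using g_cont[of i] lim[of i] by (auto intro: continuous_on_tendsto_compose)
    then have "(\<lambda>n. max 0 (g i (x i (t n)))) \<longlonglongrightarrow> max 0 (g i l)"
      by (intro tendsto_intros)
    ultimately have "max 0 (g i l) = 0" using LIMSEQ_unique by blast
    have "(\<lambda>n. (norm (x i (t n) - ?P (x i (t n))))\<^sup>2) \<longlonglongrightarrow> 0"
      by (rule Lim_null_comparison[OF _ r]) auto
    then have "(\<lambda>n. x i (t n) - ?P (x i (t n))) \<longlonglongrightarrow> 0"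
      using tendsto_real_sqrt tendsto_norm_zero_cancel by fastforce
    from tendsto_diff[OF lim[of i] this] have "(\<lambda>n. ?P (x i (t n))) \<longlonglongrightarrow> l" by simp
    moreover have "?P (x i (t n)) \<in> X i" for n
      using nonempty X_closed by (intro closest_point_in_set) (auto simp: cfp_solutions_def)
    ultimately have "l \<in> X i"
      using closed_sequentially[OF X_closed[of i], of "\<lambda>n. ?P (x i (t n))" l] by blast
    then show ?thesis using \<open>max 0 (g i l) = 0\<close> by simp
  qed
  then show ?thesis by (auto simp: cfp_solutions_def)
qed

text \<open>Compactness gives one agent a cluster point \<open>l\<close>, and consensus makes all
  agents approach \<open>l\<close> along the same times. Since \<open>l\<close> is feasible,
  \<open>energy l\<close> is decreasing; being small at one such time, it stays small from then
  on.\<close>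

lemma convergence: "\<exists>l\<in>cfp_solutions g X. \<forall>i. (x i \<longlongrightarrow> l) at_top"
proof -
  obtain c where c: "c \<in> cfp_solutions g X" using nonempty by blast
  fix k :: 'i
  have "x k (real n) \<in> cball c (sqrt (energy c 0))" for n
    using norm_le_initial_energy[OF c] by (simp add: dist_norm norm_minus_commute)
  then obtain l r where r: "strict_mono r" and l: "((\<lambda>n. x k (real n)) \<circ> r) \<longlonglongrightarrow> l"
    using compact_imp_seq_compact[OF compact_cball, of c "sqrt (energy c 0)"]
    unfolding seq_compact_def by metis
  define t where "t = (\<lambda>n. real (r n))"
  have t: "filterlim t at_top sequentially"
    unfolding t_def using filterlim_compose[OF filterlim_real_sequentially filterlim_subseq[OF r]] .
  have lim: "(\<lambda>n. x i (t n)) \<longlonglongrightarrow> l" for i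
  proof -
    have "(\<lambda>n. (x i (t n) - x k (t n)) + x k (t n)) \<longlonglongrightarrow> 0 + l"
      using l filterlim_compose[OF difference_tendsto_0 t] by (intro tendsto_add) (auto simp: t_def o_def)
    then show ?thesis by simp
  qed
  have L: "l \<in> cfp_solutions g X" by (rule limit_feasible[OF t lim])
  have "(\<lambda>n. energy l (t n)) \<longlonglongrightarrow> (\<Sum>i\<in>(UNIV::'i set). (norm (l - l))\<^sup>2)"
    unfolding energy_def by (intro tendsto_intros lim)
  then have E: "(\<lambda>n. energy l (t n)) \<longlonglongrightarrow> 0" by simp
  have "(x i \<longlongrightarrow> l) at_top" for i
    unfolding tendsto_iff
  proof (intro allI impI)
    fix e :: real assume e: "0 < e"
    then have "\<forall>\<^sub>F n in sequentially. energy l (t n) < e\<^sup>2"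
      using E by (intro order_tendstoD) auto
    then obtain n where n: "energy l (t n) < e\<^sup>2"
      by (auto simp: eventually_sequentially)
    have "dist (x i s) l < e" if "t n \<le> s" for s
    proof -
      have "(norm (x i s - l))\<^sup>2 < e\<^sup>2"
        using norm_le_energy[of i s l] energy_antimono[OF L _ that] n by (simp add: t_def)
      then show ?thesis using e by (simp add: dist_norm power_less_imp_less_base)
    qed
    then show "\<forall>\<^sub>F s in at_top. dist (x i s) l < e"
      by (auto simp: eventually_at_top_linorder)
  qed
  then show ?thesis using L by blast
qed

end

section \<open>Consensus and convergence to a common solution\<close>

theorem theorem4:
  fixes g :: "'i::finite \<Rightarrow> 'a::euclidean_space \<Rightarrow> real"
    and X :: "'i \<Rightarrow> 'a set"
    and dg :: "'i \<Rightarrow> 'a \<Rightarrow> 'a"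
    and a :: "'i \<Rightarrow> 'i \<Rightarrow> real \<Rightarrow> real"
    and x :: "'i \<Rightarrow> real \<Rightarrow> 'a"
    and \<tau> \<delta> T :: real
  assumes g_convex: "\<And>i. convex_on UNIV (g i)"
    and g_cont: "\<And>i. continuous_on UNIV (g i)"
    and X_closed: "\<And>i. closed (X i)"
    and X_convex: "\<And>i. convex (X i)"
    and dg_feas: "\<And>i z. g i z \<le> 0 \<Longrightarrow> dg i z = 0"
    and dg_subgrad: "\<And>i z. g i z > 0 \<Longrightarrow> is_subgradient (g i) z (dg i z)"
    and a_nonneg: "\<And>i j t. 0 \<le> a i j t"
    and nonempty: "cfp_solutions g X \<noteq> {}"
    and balanced: "\<And>i t. 0 \<le> t \<Longrightarrow> (\<Sum>j\<in>UNIV. a i j t) = (\<Sum>j\<in>UNIV. a j i t)"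
    and T_pos: "0 < T" and \<delta>_pos: "0 < \<delta>"
    and connected: "strongly_connected (delta_edges a \<delta> T)"
    and \<tau>_pos: "0 < \<tau>"
    and sol: "is_solution a \<tau> X dg x"
    and phi_lim: "\<And>i. (phi \<tau> X dg x i \<longlongrightarrow> 0) at_top"
  shows "(\<forall>i j. ((\<lambda>t. norm (x i t - x j t)) \<longlongrightarrow> 0) at_top)
         \<and> (\<exists>xs\<in>cfp_solutions g X. \<forall>i. (x i \<longlongrightarrow> xs) at_top)"
proof -
  interpret cfp_flow g X dg a x \<tau> \<delta> T
    using assms by unfold_locales
  show ?thesis
    using difference_tendsto_0 tendsto_norm_zero convergence by blast
qed

end
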